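(* Let $N\ge0$ be an integer. Consider the source-free infinite radiation moment system $\partial_t\mathbf{u}=R\mathbf{u}$ with $R=-\mathbf{B}\partial_x-\mathbf{C}$, the splitting of $\mathbf{u}=(u_0,u_1,\dots)^T$ into $\mathbf{u}_C=(u_0,\dots,u_N)^T$ and $\mathbf{u}_F=(u_{N+1},u_{N+2},\dots)^T$, and an infinite symmetric positive definite matrix $\mathbf{A}$, as in the context. Assume $\mathbf{A}_{FC}=\mathbf{0}$. Then $$(R\mathbf{F}R\mathbf{E})_{CC}=\mathbf{B}_{CF}\mathbf{B}_{FC}\,\partial_{xx},$$ and the $(N+1)\times(N+1)$ matrix $\mathbf{B}_{CF}\mathbf{B}_{FC}$ has the single nonzero entry $\frac{(N+1)^2}{(2N+1)(2N+3)}$, in its lower right corner (row and column index $N$). Consequently, with $\tau=\frac{1}{\sigma_{a,N+1}}$, the second order optimal prediction system $$\partial_t\mathbf{u}_C=(R\mathbf{E})_{CC}\mathbf{u}_C+\tau\,(R\mathbf{F}R\mathbf{E})_{CC}\mathbf{u}_C$$ is exactly the (source-free) diffusion correction closure $D_N$. For $N=0$ it is the classical diffusion approximation $$\partial_tu_0-\tfrac{1}{3\sigma_{a1}}\partial_{xx}u_0=-\sigma_{a0}u_0.$$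
   Context: Let $\sigma_{a0},\sigma_{a1},\dots$ be real constants, with $\sigma_{a,N+1}>0$. The infinite moment system for $u_k=u_k(x,t)$, $x\in\mathbb{R}$, $t>0$, $k=0,1,2,\dots$, is $$\partial_tu_k+b_{k,k-1}\partial_xu_{k-1}+b_{k,k+1}\partial_xu_{k+1}=-\sigma_{ak}u_k,\qquad b_{kl}=\tfrac{k+1}{2k+1}\delta_{k+1,l}+\tfrac{k}{2k+1}\delta_{k-1,l},$$ i.e. $\partial_t\mathbf{u}=R\mathbf{u}$ with $R=-\mathbf{B}\partial_x-\mathbf{C}$, where $\mathbf{B}=(b_{kl})_{k,l\ge0}$ is tridiagonal and $\mathbf{C}=\mathrm{diag}(\sigma_{a0},\sigma_{a1},\dots)$. For $k=0$ the term with $u_{-1}$ is absent. All matrices and operators are split into blocks $CC$, $CF$, $FC$, $FF$ according to the index sets $\{0,\dots,N\}$ (for $C$) and $\{N+1,N+2,\dots\}$ (for $F$). $\mathbf{A}$ is a real symmetric infinite matrix indexed by $\{0,1,2,\dots\}$ all of whose finite principal submatrices are positive definite. The projection matrices are $$\mathbf{E}=\begin{bmatrix}\mathbf{I}&\mathbf{0}\\ \mathbf{A}_{FC}\mathbf{A}_{CC}^{-1}&\mathbf{0}\end{bmatrix},\qquad \mathbf{F}=\mathbf{I}-\mathbf{E}.$$ The source-free diffusion correction closure $D_N$ is the following system for $u_0,\dots,u_N$. For $k<N$ it consists of the moment equations above, unchanged. For $k=N$ the equation is $$\partial_tu_N+b_{N,N-1}\partial_xu_{N-1}-\theta\,\partial_{xx}u_N=-\sigma_{aN}u_N,\qquad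 \theta=\frac{1}{\sigma_{a,N+1}}\frac{(N+1)^2}{(2N+1)(2N+3)},$$ where the term with $u_{N-1}$ is absent if $N=0$. *)

theory Defs
  imports
    "HOL-Analysis.Analysis"
    "Jordan_Normal_Form.Gauss_Jordan_Elimination"
    "Jordan_Normal_Form.Determinant"
begin

text \<open>
  Moments are indexed by \<open>nat\<close>. Matrix blocks keep the original indices and are extended by
  zero, so that a block such as \<open>B_CF\<close> is again a matrix on all of \<open>nat\<close>.
  All infinite matrices below except \<open>A\<close> have finitely supported rows, so the series in
  \<open>mmult\<close> and \<open>mat_op\<close> are finite sums; \<open>A\<close> itself only enters through a block with
  finitely many columns.
\<close>

type_synonym imat = "nat \<Rightarrow> nat \<Rightarrow> real"

text \<open>A sequence of functions of \<open>x\<close> (the moments at a fixed time).\<close>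
type_synonym moments = "nat \<Rightarrow> real \<Rightarrow> real"

definition Cset :: "nat \<Rightarrow> nat set" where
  "Cset N = {..N}"

definition Fset :: "nat \<Rightarrow> nat set" where
  "Fset N = {N<..}"

definition block :: "nat set \<Rightarrow> nat set \<Rightarrow> imat \<Rightarrow> imat" where
  "block I J M = (\<lambda>i j. if i \<in> I \<and> j \<in> J then M i j else 0)"

definition mmult :: "imat \<Rightarrow> imat \<Rightarrow> imat" where
  "mmult P Q = (\<lambda>i j. \<Sum>l. P i l * Q l j)"

definition symmetric_imat :: "imat \<Rightarrow> bool" where
  "symmetric_imat A \<longleftrightarrow> (\<forall>i j. A i j = A j i)"

definition principal_submatrices_pos_def :: "imat \<Rightarrow> bool" where
  "principal_submatrices_pos_def A \<longleftrightarrow>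
     (\<forall>S v. finite S \<and> (\<exists>i\<in>S. v i \<noteq> 0) \<longrightarrow> (\<Sum>i\<in>S. \<Sum>j\<in>S. v i * A i j * v j) > 0)"

definition ACC_mat :: "nat \<Rightarrow> imat \<Rightarrow> real mat" where
  "ACC_mat N A = mat (N + 1) (N + 1) (\<lambda>(i, j). A i j)"

definition ACC_inv :: "nat \<Rightarrow> imat \<Rightarrow> imat" where
  "ACC_inv N A = block (Cset N) (Cset N) (\<lambda>i j. the (mat_inverse (ACC_mat N A)) $$ (i, j))"

definition E_mat :: "nat \<Rightarrow> imat \<Rightarrow> imat" where
  "E_mat N A = (\<lambda>i j.
     if j \<in> Cset N then
       (if i \<in> Cset N then (if i = j then 1 else 0)
        else mmult (block (Fset N) (Cset N) A) (ACC_inv N A) i j)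
     else 0)"

definition F_mat :: "nat \<Rightarrow> imat \<Rightarrow> imat" where
  "F_mat N A = (\<lambda>i j. (if i = j then 1 else 0) - E_mat N A i j)"

definition B_mat :: imat where
  "B_mat k l =
     (if l = k + 1 then (real k + 1) / (2 * real k + 1) else 0)
     + (if l + 1 = k then real k / (2 * real k + 1) else 0)"

definition C_mat :: "(nat \<Rightarrow> real) \<Rightarrow> imat" where
  "C_mat \<sigma> k l = (if k = l then \<sigma> k else 0)"

text \<open>Operators on sequences of functions, and their blocks.\<close>

definition mat_op :: "imat \<Rightarrow> moments \<Rightarrow> moments" where
  "mat_op M u = (\<lambda>k x. \<Sum>l. M k l * u l x)"

definition Dx :: "moments \<Rightarrow> moments" where
  "Dx u = (\<lambda>k. deriv (u k))"

definition R_op :: "(nat \<Rightarrow> real) \<Rightarrow> moments \<Rightarrow> moments" where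
  "R_op \<sigma> u = (\<lambda>k x. - mat_op B_mat (Dx u) k x - mat_op (C_mat \<sigma>) u k x)"

definition restr :: "nat set \<Rightarrow> moments \<Rightarrow> moments" where
  "restr I u = (\<lambda>k. if k \<in> I then u k else (\<lambda>x. 0))"

definition block_op :: "nat set \<Rightarrow> nat set \<Rightarrow> (moments \<Rightarrow> moments) \<Rightarrow> moments \<Rightarrow> moments" where
  "block_op I J P = (\<lambda>u. restr I (P (restr J u)))"

definition RE_op :: "(nat \<Rightarrow> real) \<Rightarrow> nat \<Rightarrow> imat \<Rightarrow> moments \<Rightarrow> moments" where
  "RE_op \<sigma> N A = R_op \<sigma> \<circ> mat_op (E_mat N A)"

definition RFRE_op :: "(nat \<Rightarrow> real) \<Rightarrow> nat \<Rightarrow> imat \<Rightarrow> moments \<Rightarrow> moments" where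
  "RFRE_op \<sigma> N A = R_op \<sigma> \<circ> mat_op (F_mat N A) \<circ> R_op \<sigma> \<circ> mat_op (E_mat N A)"

text \<open>
  Time-dependent moments are written \<open>u k x t\<close>. Each equation is a predicate in the row \<open>k\<close>
  and the point \<open>(x, t)\<close>; a system requires it for all relevant rows, all \<open>x\<close> and all \<open>t > 0\<close>.
\<close>

type_synonym tmoments = "nat \<Rightarrow> real \<Rightarrow> real \<Rightarrow> real"

definition slice :: "tmoments \<Rightarrow> real \<Rightarrow> moments" where
  "slice u t = (\<lambda>k x. u k x t)"

definition dt :: "tmoments \<Rightarrow> tmoments" where
  "dt u k x t = deriv (\<lambda>s. u k x s) t"

definition dx :: "tmoments \<Rightarrow> tmoments" where
  "dx u k x t = deriv (\<lambda>y. u k y t) x"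

definition dxx :: "tmoments \<Rightarrow> tmoments" where
  "dxx u = dx (dx u)"

definition moment_eq :: "(nat \<Rightarrow> real) \<Rightarrow> tmoments \<Rightarrow> nat \<Rightarrow> real \<Rightarrow> real \<Rightarrow> bool" where
  "moment_eq \<sigma> u k x t \<longleftrightarrow>
     dt u k x t + (if k = 0 then 0 else B_mat k (k - 1) * dx u (k - 1) x t)
       + B_mat k (k + 1) * dx u (k + 1) x t = - \<sigma> k * u k x t"

definition theta :: "(nat \<Rightarrow> real) \<Rightarrow> nat \<Rightarrow> real" where
  "theta \<sigma> N = 1 / \<sigma> (N + 1) * ((real N + 1)\<^sup>2 / ((2 * real N + 1) * (2 * real N + 3)))"

definition diffusion_correction_eq ::
    "(nat \<Rightarrow> real) \<Rightarrow> nat \<Rightarrow> tmoments \<Rightarrow> nat \<Rightarrow> real \<Rightarrow> real \<Rightarrow> bool" where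
  "diffusion_correction_eq \<sigma> N u k x t \<longleftrightarrow>
     (if k < N then moment_eq \<sigma> u k x t
      else dt u N x t + (if N = 0 then 0 else B_mat N (N - 1) * dx u (N - 1) x t)
             - theta \<sigma> N * dxx u N x t = - \<sigma> N * u N x t)"

definition diffusion_correction_closure :: "(nat \<Rightarrow> real) \<Rightarrow> nat \<Rightarrow> tmoments \<Rightarrow> bool" where
  "diffusion_correction_closure \<sigma> N u \<longleftrightarrow>
     (\<forall>k\<in>Cset N. \<forall>x. \<forall>t>0. diffusion_correction_eq \<sigma> N u k x t)"

definition optimal_prediction2_eq ::
    "(nat \<Rightarrow> real) \<Rightarrow> nat \<Rightarrow> imat \<Rightarrow> real \<Rightarrow> tmoments \<Rightarrow> nat \<Rightarrow> real \<Rightarrow> real \<Rightarrow> bool" where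
  "optimal_prediction2_eq \<sigma> N A \<tau> u k x t \<longleftrightarrow>
     dt u k x t =
       block_op (Cset N) (Cset N) (RE_op \<sigma> N A) (slice u t) k x
       + \<tau> * block_op (Cset N) (Cset N) (RFRE_op \<sigma> N A) (slice u t) k x"

definition optimal_prediction2_system ::
    "(nat \<Rightarrow> real) \<Rightarrow> nat \<Rightarrow> imat \<Rightarrow> real \<Rightarrow> tmoments \<Rightarrow> bool" where
  "optimal_prediction2_system \<sigma> N A \<tau> u \<longleftrightarrow>
     (\<forall>k\<in>Cset N. \<forall>x. \<forall>t>0. optimal_prediction2_eq \<sigma> N A \<tau> u k x t)"

definition diffusion_approximation_eq :: "(nat \<Rightarrow> real) \<Rightarrow> tmoments \<Rightarrow> real \<Rightarrow> real \<Rightarrow> bool" where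
  "diffusion_approximation_eq \<sigma> u x t \<longleftrightarrow>
     dt u 0 x t - 1 / (3 * \<sigma> 1) * dxx u 0 x t = - \<sigma> 0 * u 0 x t"

text \<open>
  Classical regularity, needed because \<open>deriv\<close> is only meaningful for differentiable functions.
  It is imposed on the components \<open>0, \<dots>, N\<close> only.
\<close>

definition twice_differentiable :: "(real \<Rightarrow> real) \<Rightarrow> bool" where
  "twice_differentiable f \<longleftrightarrow>
     (\<forall>x. f differentiable (at x)) \<and> (\<forall>x. deriv f differentiable (at x))"

definition classical_moments :: "nat \<Rightarrow> tmoments \<Rightarrow> bool" where
  "classical_moments N u \<longleftrightarrow>
     (\<forall>k\<in>Cset N. \<forall>t>0. twice_differentiable (\<lambda>x. u k x t)) \<and>
     (\<forall>k\<in>Cset N. \<forall>x. \<forall>t>0. (\<lambda>s. u k x s) differentiable (at t))"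

text \<open>The inverse used in \<open>ACC_inv\<close> exists.\<close>

lemma ACC_mat_inverse:
  assumes "principal_submatrices_pos_def A"
  obtains M where "mat_inverse (ACC_mat N A) = Some M"
    and "ACC_mat N A * M = 1\<^sub>m (N + 1)" and "M * ACC_mat N A = 1\<^sub>m (N + 1)"
proof -
  let ?n = "N + 1"
  have cA: "ACC_mat N A \<in> carrier_mat ?n ?n" by (simp add: ACC_mat_def)
  have "Determinant.det (ACC_mat N A) \<noteq> 0"
  proof
    assume "Determinant.det (ACC_mat N A) = 0"
    then obtain v where v: "v \<in> carrier_vec ?n" "v \<noteq> 0\<^sub>v ?n" "ACC_mat N A *\<^sub>v v = 0\<^sub>v ?n"
      using det_0_iff_vec_prod_zero_field[OF cA] by auto
    have row: "(\<Sum>j<?n. A i j * v $ j) = 0" if "i < ?n" for i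
    proof -
      have "(ACC_mat N A *\<^sub>v v) $ i = 0" using v that by simp
      moreover have "(ACC_mat N A *\<^sub>v v) $ i = (\<Sum>j<?n. A i j * v $ j)"
        using v(1) that by (simp add: ACC_mat_def scalar_prod_def atLeast0LessThan)
      ultimately show ?thesis by simp
    qed
    have "\<exists>i\<in>{..<?n}. v $ i \<noteq> 0"
    proof (rule ccontr)
      assume "\<not> ?thesis"
      then have "v = 0\<^sub>v ?n" using v(1) by (intro eq_vecI) auto
      with v(2) show False by simp
    qed
    moreover have "\<exists>i\<in>S. f i \<noteq> 0 \<Longrightarrow> finite S \<Longrightarrow>
        (\<Sum>i\<in>S. \<Sum>j\<in>S. f i * A i j * f j) > 0" for S f
      using assms unfolding principal_submatrices_pos_def_def by blast
    ultimately have "(\<Sum>i<?n. \<Sum>j<?n. v $ i * A i j * v $ j) > 0"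
      using finite_lessThan by blast
    moreover have "(\<Sum>i<?n. \<Sum>j<?n. v $ i * A i j * v $ j)
        = (\<Sum>i<?n. v $ i * (\<Sum>j<?n. A i j * v $ j))"
      by (simp only: sum_distrib_left mult.assoc)
    ultimately show False using row by simp
  qed
  then have "ACC_mat N A \<in> Units (ring_mat TYPE(real) ?n ())"
    by (rule det_non_zero_imp_unit[OF cA])
  then obtain M where "mat_inverse (ACC_mat N A) = Some M"
    using mat_inverse(1)[OF cA, of "()"] by (cases "mat_inverse (ACC_mat N A)") auto
  then show thesis using mat_inverse(2)[OF cA] that by blast
qed

lemma mat_op_B:
  "mat_op B_mat v k x =
     (if k = 0 then 0 else B_mat k (k - 1) * v (k - 1) x) + B_mat k (k + 1) * v (k + 1) x"
proof -
  have "mat_op B_mat v k x = (\<Sum>l\<in>{k - 1, k + 1}. B_mat k l * v l x)"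
    unfolding mat_op_def by (rule suminf_finite) (auto simp: B_mat_def)
  then show ?thesis by (auto simp: B_mat_def)
qed

lemma mat_op_C: "mat_op (C_mat \<sigma>) v k x = \<sigma> k * v k x"
proof -
  have "mat_op (C_mat \<sigma>) v k x = (\<Sum>l\<in>{k}. C_mat \<sigma> k l * v l x)"
    unfolding mat_op_def by (rule suminf_finite) (auto simp: C_mat_def)
  then show ?thesis by (simp add: C_mat_def)
qed

lemma moment_eq_iff_R_op: "moment_eq \<sigma> u k x t \<longleftrightarrow> dt u k x t = R_op \<sigma> (slice u t) k x"
  by (auto simp: moment_eq_def R_op_def mat_op_B mat_op_C Dx_def slice_def dx_def)

end

theory Submission
  imports Defs
begin

text \<open>
  If \<open>A_FC = 0\<close>, then \<open>E\<close> and \<open>F\<close> are the coordinate projections onto the index sets \<open>C\<close> and \<open>F\<close>.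
  Since \<open>B\<close> is tridiagonal and \<open>C\<close> is diagonal, the only path \<open>C \<rightarrow> F \<rightarrow> C\<close> through \<open>R F R E\<close> is
  \<open>N \<rightarrow> N + 1 \<rightarrow> N\<close>. It uses only the transport part of \<open>R\<close>, which contributes
  \<open>b_{N,N+1} b_{N+1,N} \<partial>_xx\<close>.
\<close>

text \<open>With indicator functions for \<open>d\<close>, this turns multiplication by
  \<open>E_mat\<close> and \<open>F_mat\<close> into \<open>restr\<close>.\<close>

lemma mat_op_diag: "mat_op (\<lambda>i j. if i = j then d i else 0) v = (\<lambda>k x. d k * v k x)"
proof (intro ext)
  fix k x
  have "mat_op (\<lambda>i j. if i = j then d i else 0) v k x
      = (\<Sum>l\<in>{k}. (if k = l then d k else 0) * v l x)"
    unfolding mat_op_def by (rule suminf_finite) auto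
  then show "mat_op (\<lambda>i j. if i = j then d i else 0) v k x = d k * v k x" by simp
qed

text \<open>The only block of \<open>E_mat\<close> that depends on \<open>A\<close> has
  \<open>A_FC\<close> as its left factor and vanishes with it.\<close>

lemma E_mat_block_diagonal:
  assumes "block (Fset N) (Cset N) A = (\<lambda>i j. 0)"
  shows "E_mat N A = (\<lambda>i j. if i = j then of_bool (i \<in> Cset N) else 0)"
  by (intro ext) (auto simp: E_mat_def assms mmult_def)

lemma mat_op_E_block_diagonal:
  assumes "block (Fset N) (Cset N) A = (\<lambda>i j. 0)"
  shows "mat_op (E_mat N A) v = restr (Cset N) v"
  by (auto simp: E_mat_block_diagonal[OF assms] mat_op_diag restr_def fun_eq_iff)

lemma mat_op_F_block_diagonal:
  assumes "block (Fset N) (Cset N) A = (\<lambda>i j. 0)"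
  shows "mat_op (F_mat N A) v = restr (Fset N) v"
proof -
  have "F_mat N A = (\<lambda>i j. if i = j then of_bool (i \<in> Fset N) else 0)"
    by (intro ext)
      (auto simp: F_mat_def E_mat_block_diagonal[OF assms] Cset_def Fset_def)
  then show ?thesis
    by (simp only: mat_op_diag) (auto simp: restr_def)
qed

lemma restr_idem [simp]: "restr I (restr I v) = restr I v"
  by (auto simp: restr_def)

lemma R_op_eq:
  "R_op \<sigma> v k x =
     - (if k = 0 then 0 else B_mat k (k - 1) * deriv (v (k - 1)) x)
     - B_mat k (k + 1) * deriv (v (k + 1)) x - \<sigma> k * v k x"
  by (simp add: R_op_def mat_op_B mat_op_C Dx_def)

lemma B_mat_transition_product:
  "B_mat N (N + 1) * B_mat (N + 1) N = (real N + 1)\<^sup>2 / ((2 * real N + 1) * (2 * real N + 3))"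
  by (simp add: B_mat_def power2_eq_square algebra_simps)

text \<open>By tridiagonality the blocks \<open>B_CF\<close> and \<open>B_FC\<close> have one
  nonzero entry each, at (N, N + 1) and (N + 1, N), so only the intermediate index N + 1
  contributes.\<close>

lemma mmult_B_CF_B_FC:
  "mmult (block (Cset N) (Fset N) B_mat) (block (Fset N) (Cset N) B_mat) k l =
     (if k = N \<and> l = N then (real N + 1)\<^sup>2 / ((2 * real N + 1) * (2 * real N + 3)) else 0)"
proof -
  have "mmult (block (Cset N) (Fset N) B_mat) (block (Fset N) (Cset N) B_mat) k l
      = (\<Sum>j\<in>{N + 1}. block (Cset N) (Fset N) B_mat k j * block (Fset N) (Cset N) B_mat j l)"
    unfolding mmult_def
    by (rule suminf_finite) (auto simp: block_def B_mat_def Cset_def Fset_def)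
  also have "\<dots> = (if k = N \<and> l = N then B_mat N (N + 1) * B_mat (N + 1) N else 0)"
    by (auto simp: block_def B_mat_def Cset_def Fset_def)
  finally show ?thesis
    by (simp only: B_mat_transition_product)
qed

lemma mat_op_B_CF_B_FC:
  "mat_op (mmult (block (Cset N) (Fset N) B_mat) (block (Fset N) (Cset N) B_mat)) v k x =
     (if k = N then (real N + 1)\<^sup>2 / ((2 * real N + 1) * (2 * real N + 3)) * v N x else 0)"
proof -
  have "mat_op (mmult (block (Cset N) (Fset N) B_mat) (block (Fset N) (Cset N) B_mat)) v k x
      = (\<Sum>l\<in>{N}. mmult (block (Cset N) (Fset N) B_mat) (block (Fset N) (Cset N) B_mat) k l * v l x)"
    unfolding mat_op_def by (rule suminf_finite) (auto simp: mmult_B_CF_B_FC)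
  then show ?thesis
    by (simp add: mmult_B_CF_B_FC)
qed

text \<open>First crossing, from C to F: among the rows above N only N + 1 has a neighbour in C. The
  damping term is diagonal and acts there on zero components.\<close>

lemma restr_F_R_op_restr_C:
  "restr (Fset N) (R_op \<sigma> (restr (Cset N) v)) =
     (\<lambda>k. if k = N + 1 then (\<lambda>x. - B_mat (N + 1) N * deriv (v N) x) else (\<lambda>x. 0))"
  by (intro ext) (auto simp: restr_def R_op_eq Cset_def Fset_def)

text \<open>The first order part is plain truncation: row N loses its flux term because component N
  + 1 is replaced by zero.\<close>

lemma block_RE_op:
  assumes "block (Fset N) (Cset N) A = (\<lambda>i j. 0)" and "k \<in> Cset N"
  shows "block_op (Cset N) (Cset N) (RE_op \<sigma> N A) v k x =
     - (if k = 0 then 0 else B_mat k (k - 1) * deriv (v (k - 1)) x)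
     - (if k < N then B_mat k (k + 1) * deriv (v (k + 1)) x else 0) - \<sigma> k * v k x"
  using assms(2)
  by (auto simp: block_op_def RE_op_def mat_op_E_block_diagonal[OF assms(1)] restr_def
      R_op_eq Cset_def)

lemma block_RFRE_op:
  assumes "block (Fset N) (Cset N) A = (\<lambda>i j. 0)"
    and "twice_differentiable (v N)"
  shows "block_op (Cset N) (Cset N) (RFRE_op \<sigma> N A) v =
    mat_op (mmult (block (Cset N) (Fset N) B_mat) (block (Fset N) (Cset N) B_mat)) (Dx (Dx v))"
proof (intro ext)
  fix k x
  let ?w = "\<lambda>k. if k = N + 1 then (\<lambda>x. - B_mat (N + 1) N * deriv (v N) x) else (\<lambda>x. 0)"
  \<comment> \<open>The constant can be pulled out of the outer \<open>deriv\<close> because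
    \<open>deriv (v N)\<close> is itself differentiable.\<close>
  have "(deriv (v N) has_field_derivative deriv (deriv (v N)) x) (at x)"
    using assms(2)
    by (simp add: twice_differentiable_def DERIV_deriv_iff_real_differentiable)
  then have deriv_w: "deriv (?w (N + 1)) x = - B_mat (N + 1) N * deriv (deriv (v N)) x"
    by (simp only: simp_thms if_True) (intro DERIV_imp_deriv DERIV_cmult)
  have "block_op (Cset N) (Cset N) (RFRE_op \<sigma> N A) v k x
      = restr (Cset N) (R_op \<sigma> ?w) k x"
    by (simp only: block_op_def RFRE_op_def o_apply mat_op_E_block_diagonal[OF assms(1)]
        mat_op_F_block_diagonal[OF assms(1)] restr_idem restr_F_R_op_restr_C)
  \<comment> \<open>Second crossing, back to C: \<open>?w\<close> vanishes except at N + 1, which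
    among the rows of C only row N reads, and only through its transport term.\<close>
  also have "\<dots> = (if k = N then - B_mat N (N + 1) * deriv (?w (N + 1)) x else 0)"
    by (auto simp: restr_def R_op_eq Cset_def)
  \<comment> \<open>Each crossing carries one minus sign from \<open>R_op\<close>; the two
    cancel.\<close>
  also have "\<dots> = (if k = N then B_mat N (N + 1) * B_mat (N + 1) N * deriv (deriv (v N)) x else 0)"
    by (simp only: deriv_w) simp
  finally show "block_op (Cset N) (Cset N) (RFRE_op \<sigma> N A) v k x =
      mat_op (mmult (block (Cset N) (Fset N) B_mat) (block (Fset N) (Cset N) B_mat)) (Dx (Dx v)) k x"
    by (simp only: mat_op_B_CF_B_FC B_mat_transition_product Dx_def)
qed

text \<open>Truncation leaves the rows below N unchanged. In row N the missing flux is replaced by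
  the second order term, whose coefficient is \<open>theta \<sigma> N\<close> for this choice of
  \<tau>.\<close>

lemma optimal_prediction2_eq_iff_diffusion_correction_eq:
  assumes A: "block (Fset N) (Cset N) A = (\<lambda>i j. 0)"
    and u: "classical_moments N u" and k: "k \<in> Cset N" and t: "t > 0"
  shows "optimal_prediction2_eq \<sigma> N A (1 / \<sigma> (N + 1)) u k x t
    \<longleftrightarrow> diffusion_correction_eq \<sigma> N u k x t"
proof -
  have "twice_differentiable (slice u t N)"
    using u t by (simp add: classical_moments_def slice_def Cset_def)
  note RFRE = block_RFRE_op[where v = "slice u t", OF A this]
  have second: "1 / \<sigma> (N + 1) * block_op (Cset N) (Cset N) (RFRE_op \<sigma> N A) (slice u t) k x
      = (if k = N then theta \<sigma> N * dxx u N x t else 0)"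
    unfolding RFRE mat_op_B_CF_B_FC
    by (simp add: theta_def dxx_def dx_def[abs_def] Dx_def slice_def)
  show ?thesis
    unfolding optimal_prediction2_eq_def second block_RE_op[OF A k]
      diffusion_correction_eq_def moment_eq_def
    using k by (auto simp: slice_def dx_def Cset_def)
qed

text \<open>Here \<open>theta \<sigma> 0\<close> equals \<open>1 / (3 * \<sigma> 1)\<close>.\<close>

lemma diffusion_correction_eq_0:
  "diffusion_correction_eq \<sigma> 0 u 0 x t \<longleftrightarrow> diffusion_approximation_eq \<sigma> u x t"
  by (simp add: diffusion_correction_eq_def diffusion_approximation_eq_def theta_def mult.commute)

theorem mainTheorem3:
  fixes N :: nat and \<sigma> :: "nat \<Rightarrow> real" and A :: imat
  assumes "\<sigma> (N + 1) > 0"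
    and "symmetric_imat A"
    and "principal_submatrices_pos_def A"
    and "block (Fset N) (Cset N) A = (\<lambda>i j. 0)"
  shows "(\<forall>v. (\<forall>k\<in>Cset N. twice_differentiable (v k)) \<longrightarrow>
            block_op (Cset N) (Cset N) (RFRE_op \<sigma> N A) v =
              mat_op (mmult (block (Cset N) (Fset N) B_mat) (block (Fset N) (Cset N) B_mat))
                (Dx (Dx v)))
     \<and> (\<forall>k\<in>Cset N. \<forall>l\<in>Cset N.
            mmult (block (Cset N) (Fset N) B_mat) (block (Fset N) (Cset N) B_mat) k l =
              (if k = N \<and> l = N
               then (real N + 1)\<^sup>2 / ((2 * real N + 1) * (2 * real N + 3)) else 0))
     \<and> (\<forall>u. classical_moments N u \<longrightarrow>
            (\<forall>k\<in>Cset N. \<forall>x. \<forall>t>0.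
               optimal_prediction2_eq \<sigma> N A (1 / \<sigma> (N + 1)) u k x t
                 \<longleftrightarrow> diffusion_correction_eq \<sigma> N u k x t)
            \<and> (optimal_prediction2_system \<sigma> N A (1 / \<sigma> (N + 1)) u
                 \<longleftrightarrow> diffusion_correction_closure \<sigma> N u))
     \<and> (N = 0 \<longrightarrow> (\<forall>u. classical_moments N u \<longrightarrow>
            (\<forall>x. \<forall>t>0. optimal_prediction2_eq \<sigma> N A (1 / \<sigma> (N + 1)) u 0 x t
                 \<longleftrightarrow> diffusion_approximation_eq \<sigma> u x t)
            \<and> (optimal_prediction2_system \<sigma> N A (1 / \<sigma> (N + 1)) u
                 \<longleftrightarrow> (\<forall>x. \<forall>t>0. diffusion_approximation_eq \<sigma> u x t))))"
proof (intro conjI allI impI ballI)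
  show "block_op (Cset N) (Cset N) (RFRE_op \<sigma> N A) v =
      mat_op (mmult (block (Cset N) (Fset N) B_mat) (block (Fset N) (Cset N) B_mat)) (Dx (Dx v))"
    if "\<forall>k\<in>Cset N. twice_differentiable (v k)" for v
    using block_RFRE_op[OF assms(4)] that by (simp add: Cset_def)
  show "mmult (block (Cset N) (Fset N) B_mat) (block (Fset N) (Cset N) B_mat) k l =
      (if k = N \<and> l = N then (real N + 1)\<^sup>2 / ((2 * real N + 1) * (2 * real N + 3)) else 0)" for k l
    by (rule mmult_B_CF_B_FC)
next
  fix u assume u: "classical_moments N u"
  note eq_iff = optimal_prediction2_eq_iff_diffusion_correction_eq[OF assms(4) u]
  show "optimal_prediction2_eq \<sigma> N A (1 / \<sigma> (N + 1)) u k x t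
      \<longleftrightarrow> diffusion_correction_eq \<sigma> N u k x t" if "k \<in> Cset N" "t > 0" for k x t
    using that by (rule eq_iff)
  show system_iff: "optimal_prediction2_system \<sigma> N A (1 / \<sigma> (N + 1)) u
      \<longleftrightarrow> diffusion_correction_closure \<sigma> N u"
    unfolding optimal_prediction2_system_def diffusion_correction_closure_def
    using eq_iff by blast
  assume N: "N = 0"
  show "optimal_prediction2_eq \<sigma> N A (1 / \<sigma> (N + 1)) u 0 x t
      \<longleftrightarrow> diffusion_approximation_eq \<sigma> u x t" if "t > 0" for x t
    using eq_iff[where k = 0 and x = x] that by (simp add: N Cset_def diffusion_correction_eq_0)
  show "optimal_prediction2_system \<sigma> N A (1 / \<sigma> (N + 1)) u
      \<longleftrightarrow> (\<forall>x. \<forall>t>0. diffusion_approximation_eq \<sigma> u x t)"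
    \<comment> \<open>For N = 0 the set \<open>Cset N\<close> is {0}, so the system consists of a
      single row.\<close>
    unfolding system_iff diffusion_correction_closure_def
    by (simp add: N Cset_def diffusion_correction_eq_0)
qed

end
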